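(* For all $\alpha \in (3/2, 2)$ and for all $\delta \geqslant 0$, $$\frac{1}{m^{2\alpha-3}} \log \mathbb{P}(d_{m,m} \geqslant m^\alpha \delta) \xrightarrow[m\to \infty]{} -6 \delta^2 .$$
   Context: Hashing with linear probing (parking on a circle): for integers $1\leqslant m$ and $0 \leqslant n \leqslant m$, there are $m$ parking spaces numbered $1,\dots,m$ and arranged cyclically ($m$ is followed by $1$). $n$ cars arrive sequentially; their addresses are independent and uniformly distributed on $\{1,\dots,m\}$. A car with address $h$ parks at the first unoccupied space in the cyclic order $h, h+1,\dots,m,1,2,\dots,h-1$. The displacement of a car is the number of spaces it moves from its address to the space where it parks (it is $0$ if its address is unoccupied). The total displacement $d_{m,n}$ is the sum of the displacements of the $n$ cars. The case $n=m$ is that of full tables. *)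

theory Defs
  imports "HOL-Probability.Probability"
begin

text \<open>
  The parking spaces are the elements of \<open>{1..m}\<close>. The cars are indexed by \<open>{1..n}\<close> in order of
  arrival, and \<open>a i\<close> is the address of car \<open>i\<close>.
\<close>

text \<open>The space reached from space \<open>h\<close> after \<open>k\<close> moves; space \<open>m\<close> is followed by space \<open>1\<close>.\<close>

definition space_after :: "nat \<Rightarrow> nat \<Rightarrow> nat \<Rightarrow> nat" where
  "space_after m h k = (h - 1 + k) mod m + 1"

text \<open>
  The least element below exists as soon as some space of \<open>{1..m}\<close> lies outside the set \<open>S\<close> of
  occupied spaces. This is the case at every arrival when \<open>n \<le> m\<close>.
\<close>

definition displacement :: "nat \<Rightarrow> nat set \<Rightarrow> nat \<Rightarrow> nat" where
  "displacement m S h = (LEAST k. space_after m h k \<notin> S)"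

definition parks_at :: "nat \<Rightarrow> nat set \<Rightarrow> nat \<Rightarrow> nat" where
  "parks_at m S h = space_after m h (displacement m S h)"

text \<open>\<open>occupied m a i\<close> is the set of occupied spaces once cars \<open>1, \<dots>, i\<close> have parked.\<close>

primrec occupied :: "nat \<Rightarrow> (nat \<Rightarrow> nat) \<Rightarrow> nat \<Rightarrow> nat set" where
  "occupied m a 0 = {}"
| "occupied m a (Suc i) =
     insert (parks_at m (occupied m a i) (a (Suc i))) (occupied m a i)"

definition total_displacement :: "nat \<Rightarrow> nat \<Rightarrow> (nat \<Rightarrow> nat) \<Rightarrow> nat" where
  "total_displacement m n a = (\<Sum>i = 1..n. displacement m (occupied m a (i - 1)) (a i))"

text \<open>
  The joint law of \<open>n\<close> independent addresses, each uniform on \<open>{1..m}\<close> (for \<open>m \<ge> 1\<close>).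
  The value \<open>0\<close> is only the default outside the index set \<open>{1..n}\<close>.
\<close>

definition addresses :: "nat \<Rightarrow> nat \<Rightarrow> (nat \<Rightarrow> nat) pmf" where
  "addresses m n = Pi_pmf {1..n} 0 (\<lambda>_. pmf_of_set {1..m})"

end

theory Submission
  imports Defs "HOL-Real_Asymp.Real_Asymp"
begin

text \<open>
  The total displacement of a full table is, up to a factor \<open>m\<close> in probability, as large as a sum of
  independent centred variables, the drift \<open>\<Sum>\<^sub>i ((m + 1) / 2 - a i)\<close>.

  All spaces are filled in the end, so the drift is also the sum over the cars of
  (final space) \<open>-\<close> (address), where spaces are compared as numbers. A car that does not pass from
  space \<open>m\<close> to space \<open>1\<close> contributes its displacement to this sum; a car that does contributes its
  displacement minus \<open>m\<close>. So the drift never exceeds the total displacement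
  (\<open>drift_le_total_displacement\<close>). On the other hand, let \<open>e\<close> be the space where the last car parks.
  It is free whenever a car arrives, so no car passes beyond it. If the circle is renumbered so that
  \<open>e\<close> becomes space \<open>m\<close>, the total displacement is exactly the drift of the renumbered addresses
  (\<open>total_displacement_eq_drift\<close>). Only \<open>m\<close> renumberings are possible and each of them
  preserves the law of the addresses; a union bound gives
  \<open>P (drift \<ge> x) \<le> P (total displacement \<ge> x) \<le> m P (drift \<ge> x)\<close>
  (\<open>prob_total_displacement_bounds\<close>). The factor \<open>m\<close> costs \<open>ln m\<close>, which is negligible at speed
  \<open>m powr (2 * \<alpha> - 3)\<close> because \<open>\<alpha> > 3 / 2\<close>.

  What remains is a moderate deviation principle for the drift, a sum of \<open>m\<close> independent variables
  of variance about \<open>m\<^sup>2 / 12\<close>. The relevant exponential tilts, multiplied by the size \<open>m\<close> of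
  the variables, are of order \<open>m powr (\<alpha> - 2)\<close>. They tend to zero because \<open>\<alpha> < 2\<close>, so the scaled
  cumulant generating function converges to the Gaussian one, \<open>t\<^sup>2 / 24\<close> (\<open>drift_cgf_limit\<close>). The
  rate is then its Legendre transform \<open>6 * \<delta>\<^sup>2\<close>, by the Gaertner-Ellis argument for
  quadratic functions (\<open>quadratic_cgf_large_deviations\<close>).
\<close>

section \<open>Parking and rotations of the circle\<close>

text \<open>
  The rotation of the circle that takes space \<open>e\<close> to space \<open>m\<close>. It fixes \<open>0\<close>, the default address, so
  that composing with it maps address functions to address functions.
\<close>

definition rotate_space :: "nat \<Rightarrow> nat \<Rightarrow> nat \<Rightarrow> nat" where
  "rotate_space m e s = (if s = 0 then 0 else (s + (m - e) - 1) mod m + 1)"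

lemma rotate_space_in:
  assumes "0 < m" "0 < s"
  shows "rotate_space m e s \<in> {1..m}"
  using assms by (auto simp: rotate_space_def Suc_le_eq)

lemma rotate_space_inverse:
  assumes "e \<le> m" "s \<in> {1..m}"
  shows "rotate_space m (m - e) (rotate_space m e s) = s"
proof -
  have "((s + (m - e) - 1) mod m + e) mod m = (s + (m - e) - 1 + e) mod m"
    by (simp add: mod_add_left_eq)
  also have "s + (m - e) - 1 + e = (s - 1) + m" using assms by auto
  also have "((s - 1) + m) mod m = s - 1"
    unfolding mod_add_self2 using assms by (intro mod_less) auto
  finally show ?thesis using assms by (auto simp: rotate_space_def)
qed

lemma bij_betw_rotate_space:
  assumes "e \<le> m" shows "bij_betw (rotate_space m e) {1..m} {1..m}"
proof (cases "m = 0")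
  case False
  have "rotate_space m e (rotate_space m (m - e) s) = s" if "s \<in> {1..m}" for s
    using rotate_space_inverse[of "m - e" m s] that assms by simp
  then show ?thesis
    using rotate_space_in[of m] rotate_space_inverse[OF assms] False
    by (intro bij_betw_byWitness[where f' = "rotate_space m (m - e)"]) auto
qed (simp add: bij_betw_def)

lemma rotate_space_space_after:
  assumes "0 < h"
  shows "rotate_space m e (space_after m h k) = (rotate_space m e h - 1 + k) mod m + 1"
proof -
  have "((h - 1 + k) mod m + (m - e)) mod m = (h - 1 + k + (m - e)) mod m"
    by (rule mod_add_left_eq)
  also have "h - 1 + k + (m - e) = h + (m - e) - 1 + k" using assms by simp
  also have "\<dots> mod m = ((h + (m - e) - 1) mod m + k) mod m"
    by (rule mod_add_left_eq[symmetric])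
  finally show ?thesis using assms by (simp add: rotate_space_def space_after_def)
qed

lemma space_after_in:
  assumes "0 < m"
  shows "space_after m h k \<in> {1..m}"
  using mod_less_divisor[OF assms, of "h - 1 + k"]
  unfolding space_after_def atLeastAtMost_iff by linarith

text \<open>
  The rotated address of a car tells how far the car is from \<open>e\<close>. A free space \<open>e\<close> therefore bounds
  the displacement, and its rotation turns parking into addition without wrap-around.
\<close>

lemma space_after_last:
  assumes "e \<in> {1..m}" "0 < h"
  shows "space_after m h (m - rotate_space m e h) = e"
proof -
  have m: "0 < m" using assms by auto
  have *: "rotate_space m e h \<in> {1..m}" using m assms(2) by (rule rotate_space_in)
  have "rotate_space m e (space_after m h (m - rotate_space m e h)) = m - 1 + 1"
    using rotate_space_space_after[OF assms(2), of m e "m - rotate_space m e h"] * m by simp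
  also have "\<dots> = rotate_space m e e"
    using assms m by (simp add: rotate_space_def)
  finally have "rotate_space m e (space_after m h (m - rotate_space m e h)) = rotate_space m e e" .
  moreover have "space_after m h (m - rotate_space m e h) \<in> {1..m}"
    using m by (rule space_after_in)
  ultimately show ?thesis
    using bij_betw_rotate_space[of e m] assms by (auto simp: bij_betw_def dest: inj_onD)
qed

lemma displacement_le:
  assumes "e \<in> {1..m}" "e \<notin> S" "0 < h"
  shows "displacement m S h \<le> m - rotate_space m e h"
  unfolding displacement_def by (rule Least_le) (simp only: space_after_last[OF assms(1,3)] assms not_False_eq_True)

lemma parks_at_notin:
  assumes "e \<in> {1..m}" "e \<notin> S" "0 < h"
  shows "parks_at m S h \<notin> S"
  unfolding parks_at_def displacement_def
  by (rule LeastI[of _ "m - rotate_space m e h"]) (simp only: space_after_last[OF assms(1,3)] assms not_False_eq_True)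

lemma rotate_parks_at:
  assumes "e \<in> {1..m}" "e \<notin> S" "0 < h"
  shows "rotate_space m e (parks_at m S h) = rotate_space m e h + displacement m S h"
proof -
  have *: "rotate_space m e h \<in> {1..m}" using assms by (intro rotate_space_in) auto
  have "(rotate_space m e h - 1 + displacement m S h) mod m =
      rotate_space m e h - 1 + displacement m S h"
    using displacement_le[OF assms] * by (intro mod_less) auto
  then show ?thesis
    using * assms by (simp add: parks_at_def rotate_space_space_after)
qed

text \<open>A car that passes from space \<open>m\<close> to space \<open>1\<close> loses \<open>m\<close> in number, so equality may fail.\<close>

lemma parks_at_le: "0 < h \<Longrightarrow> parks_at m S h \<le> h + displacement m S h"
  unfolding parks_at_def space_after_def
  using mod_less_eq_dividend[of "h - 1 + displacement m S h" m] by linarith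

definition parking_space :: "nat \<Rightarrow> (nat \<Rightarrow> nat) \<Rightarrow> nat \<Rightarrow> nat" where
  "parking_space m a i = parks_at m (occupied m a (i - 1)) (a i)"

lemma occupied_conv_parking_space: "occupied m a n = parking_space m a ` {1..n}"
  by (induction n) (auto simp: parking_space_def atLeastAtMostSuc_conv)

lemma occupied_mono: "i \<le> j \<Longrightarrow> occupied m a i \<subseteq> occupied m a j"
  by (auto simp: occupied_conv_parking_space)

lemma occupied_subset: "0 < m \<Longrightarrow> occupied m a n \<subseteq> {1..m}"
  using space_after_in unfolding occupied_conv_parking_space
  by (auto simp: parking_space_def parks_at_def simp del: atLeastAtMost_iff)

lemma card_occupied:
  assumes "\<And>i. i \<in> {1..n} \<Longrightarrow> 0 < a i" and "n \<le> m"
  shows "card (occupied m a n) = n"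
  using assms
proof (induction n)
  case (Suc n)
  have card: "card (occupied m a n) = n" using Suc by simp
  have sub: "occupied m a n \<subseteq> {1..m}" using Suc.prems by (intro occupied_subset) simp
  have "occupied m a n \<noteq> {1..m}" using card Suc.prems by auto
  then obtain e where "e \<in> {1..m}" "e \<notin> occupied m a n" using sub by blast
  then have "parks_at m (occupied m a n) (a (Suc n)) \<notin> occupied m a n"
    using Suc.prems by (intro parks_at_notin) auto
  then show ?case using card finite_subset[OF sub] by simp
qed simp

lemma bij_betw_parking_space:
  assumes "\<And>i. i \<in> {1..m} \<Longrightarrow> 0 < a i"
  shows "bij_betw (parking_space m a) {1..m} {1..m}"
proof (cases "m = 0")
  case False
  have c: "card (parking_space m a ` {1..m}) = card {1..m}"
    using card_occupied[of m a m] assms by (simp add: occupied_conv_parking_space)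
  then have "inj_on (parking_space m a) {1..m}" by (intro eq_card_imp_inj_on) auto
  moreover have "parking_space m a ` {1..m} = {1..m}"
    using False c occupied_subset[of m a m]
    by (intro card_subset_eq) (auto simp: occupied_conv_parking_space)
  ultimately show ?thesis by (simp add: bij_betw_def)
qed (simp add: bij_betw_def)

section \<open>Total displacement and drift\<close>

definition drift :: "nat \<Rightarrow> (nat \<Rightarrow> nat) \<Rightarrow> real" where
  "drift m a = (\<Sum>i = 1..m. (real m + 1) / 2 - real (a i))"

lemma drift_eq_sum_differences:
  assumes "bij_betw p {1..m} {1..m}"
  shows "drift m a = (\<Sum>i = 1..m. real (p i) - real (a i))"
proof -
  have "(\<Sum>i = 1..m. real (p i)) = (\<Sum>i = 1..m. real i)"
    using sum.reindex_bij_betw[OF assms, of real] by simp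
  also have "\<dots> = (\<Sum>i = 1..m. (real m + 1) / 2)"
    using double_gauss_sum_from_Suc_0[of m, where 'a = real] by (simp add: field_simps)
  finally show ?thesis by (simp add: drift_def sum_subtractf)
qed

lemma drift_le_total_displacement:
  assumes "\<And>i. i \<in> {1..m} \<Longrightarrow> 0 < a i"
  shows "drift m a \<le> real (total_displacement m m a)"
proof -
  have bij: "bij_betw (parking_space m a) {1..m} {1..m}"
    using assms by (rule bij_betw_parking_space)
  show ?thesis
    unfolding drift_eq_sum_differences[OF bij] total_displacement_def of_nat_sum
  proof (intro sum_mono)
    fix i assume "i \<in> {1..m}"
    then have "parking_space m a i \<le> a i + displacement m (occupied m a (i - 1)) (a i)"
      unfolding parking_space_def by (intro parks_at_le assms)
    then show "real (parking_space m a i) - real (a i) \<le>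
        real (displacement m (occupied m a (i - 1)) (a i))"
      by linarith
  qed
qed

text \<open>
  The space filled last is free at every arrival, so, numbered from there, no car wraps around.
\<close>

lemma total_displacement_eq_drift:
  assumes "0 < m" and pos: "\<And>i. i \<in> {1..m} \<Longrightarrow> 0 < a i"
  obtains e where "e \<in> {1..m}"
    "real (total_displacement m m a) = drift m (rotate_space m e \<circ> a)"
proof -
  define e where "e = parking_space m a m"
  have bij: "bij_betw (parking_space m a) {1..m} {1..m}"
    using pos by (rule bij_betw_parking_space)
  have e: "e \<in> {1..m}" unfolding e_def using bij_betw_apply[OF bij, of m] assms(1) by simp
  have free: "e \<notin> occupied m a (i - 1)" if "i \<in> {1..m}" for i
  proof -
    have "parking_space m a j \<noteq> parking_space m a m" if "j \<in> {1..m - 1}" for j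
    proof -
      have "j \<in> {1..m}" "m \<in> {1..m}" "j \<noteq> m" using that assms(1) by auto
      then show ?thesis using inj_onD[OF bij_betw_imp_inj_on[OF bij], of j m] by blast
    qed
    then have "e \<notin> occupied m a (m - 1)"
      unfolding e_def occupied_conv_parking_space by (metis imageE)
    moreover have "i - 1 \<le> m - 1" using that by auto
    ultimately show ?thesis using occupied_mono by blast
  qed
  have "bij_betw (rotate_space m e \<circ> parking_space m a) {1..m} {1..m}"
    using bij bij_betw_rotate_space[of e m] e by (auto intro: bij_betw_trans)
  then have "drift m (rotate_space m e \<circ> a) =
      (\<Sum>i = 1..m. real (rotate_space m e (parking_space m a i)) - real (rotate_space m e (a i)))"
    by (simp add: drift_eq_sum_differences)
  also have "\<dots> = real (total_displacement m m a)"
    unfolding total_displacement_def of_nat_sum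
  proof (intro sum.cong refl)
    fix i assume i: "i \<in> {1..m}"
    show "real (rotate_space m e (parking_space m a i)) - real (rotate_space m e (a i)) =
        real (displacement m (occupied m a (i - 1)) (a i))"
      using rotate_parks_at[OF e free[OF i] pos[OF i]] by (simp add: parking_space_def)
  qed
  finally show ?thesis using that e by simp
qed

section \<open>Random addresses\<close>

lemma set_pmf_addresses:
  assumes "0 < m"
  shows "set_pmf (addresses m n) = PiE_dflt {1..n} 0 (\<lambda>_. {1..m})"
  using assms by (simp add: addresses_def set_Pi_pmf o_def)

lemma finite_set_pmf_addresses: "0 < m \<Longrightarrow> finite (set_pmf (addresses m n))"
  by (simp add: set_pmf_addresses finite_PiE_dflt)

lemma addresses_rotation_invariant:
  assumes "0 < m" "e \<le> m"
  shows "map_pmf (\<lambda>a. rotate_space m e \<circ> a) (addresses m n) = addresses m n"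
proof -
  have "map_pmf (rotate_space m e) (pmf_of_set {1..m}) = pmf_of_set {1..m}"
    using bij_betw_rotate_space assms by (intro map_pmf_of_set_bij_betw) auto
  then show ?thesis
    using Pi_pmf_map[of "{1..n}" "rotate_space m e" 0 0 "\<lambda>_. pmf_of_set {1..m}"]
    by (simp add: addresses_def rotate_space_def)
qed

text \<open>
  The upper bound is a union bound over the space filled last; by rotation invariance its \<open>m\<close> terms
  are equal.
\<close>

lemma prob_total_displacement_bounds:
  assumes "0 < m"
  shows "measure_pmf.prob (addresses m m) {a. x \<le> drift m a}
      \<le> measure_pmf.prob (addresses m m) {a. x \<le> real (total_displacement m m a)}" (is ?lower)
    and "measure_pmf.prob (addresses m m) {a. x \<le> real (total_displacement m m a)}
      \<le> real m * measure_pmf.prob (addresses m m) {a. x \<le> drift m a}" (is ?upper)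
proof -
  let ?P = "measure_pmf.prob (addresses m m)"
  have pos: "0 < a i" if "a \<in> set_pmf (addresses m m)" "i \<in> {1..m}" for a i
    using that assms by (fastforce simp: set_pmf_addresses PiE_dflt_def)
  show ?lower
    using pos
    by (intro measure_pmf.finite_measure_mono_AE)
      (auto simp: AE_measure_pmf_iff intro: order_trans[OF _ drift_le_total_displacement])
  have "?P {a. x \<le> real (total_displacement m m a)}
      \<le> ?P (\<Union>e\<in>{1..m}. {a. x \<le> drift m (rotate_space m e \<circ> a)})"
  proof (intro measure_pmf.finite_measure_mono_AE)
    show "AE a in addresses m m. a \<in> {a. x \<le> real (total_displacement m m a)} \<longrightarrow>
        a \<in> (\<Union>e\<in>{1..m}. {a. x \<le> drift m (rotate_space m e \<circ> a)})"
      unfolding AE_measure_pmf_iff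
    proof safe
      fix a assume a: "a \<in> set_pmf (addresses m m)" "x \<le> real (total_displacement m m a)"
      obtain e where "e \<in> {1..m}" "real (total_displacement m m a) = drift m (rotate_space m e \<circ> a)"
        using total_displacement_eq_drift[OF assms, of a] pos[OF a(1)] by blast
      then show "a \<in> (\<Union>e\<in>{1..m}. {a. x \<le> drift m (rotate_space m e \<circ> a)})"
        using a by auto
    qed
  qed simp
  also have "\<dots> \<le> (\<Sum>e = 1..m. ?P {a. x \<le> drift m (rotate_space m e \<circ> a)})"
    by (intro measure_pmf.finite_measure_subadditive_finite) auto
  also have "\<dots> = (\<Sum>e = 1..m. ?P {a. x \<le> drift m a})"
  proof (intro sum.cong refl)
    fix e assume "e \<in> {1..m}"
    then have "?P {a. x \<le> drift m a} =
        measure_pmf.prob (map_pmf (\<lambda>a. rotate_space m e \<circ> a) (addresses m m)) {a. x \<le> drift m a}"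
      using assms by (simp add: addresses_rotation_invariant)
    then show "?P {a. x \<le> drift m (rotate_space m e \<circ> a)} = ?P {a. x \<le> drift m a}"
      by (simp add: vimage_def)
  qed
  finally show ?upper by simp
qed

section \<open>Large deviations for quadratic cumulant generating functions\<close>

text \<open>
  A lower bound for the tail in terms of moment generating functions alone, which does the work of a
  change of measure: under the law tilted by \<open>s\<close>, the mass outside the window from \<open>x\<close> to \<open>y\<close> is
  controlled by two Chernoff bounds with additional tilt \<open>h\<close> in either direction, and inside the
  window the density of the tilt is at most \<open>exp (s * y)\<close>.
\<close>

lemma mgf_le_shifted_mgfs_plus_tail:
  fixes M :: "'a pmf" and Y :: "'a \<Rightarrow> real"
  assumes int: "\<And>t. integrable (measure_pmf M) (\<lambda>\<omega>. exp (t * Y \<omega>))"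
    and "0 \<le> s" "0 \<le> h"
  shows "measure_pmf.expectation M (\<lambda>\<omega>. exp (s * Y \<omega>)) \<le>
      exp (h * x) * measure_pmf.expectation M (\<lambda>\<omega>. exp ((s - h) * Y \<omega>)) +
      exp (- h * y) * measure_pmf.expectation M (\<lambda>\<omega>. exp ((s + h) * Y \<omega>)) +
      exp (s * y) * measure_pmf.prob M {\<omega>. x \<le> Y \<omega>}"
proof -
  have ind: "integrable (measure_pmf M) (indicator {\<omega>. x \<le> Y \<omega>} :: _ \<Rightarrow> real)"
    by (simp add: measure_pmf.emeasure_eq_measure)
  have "measure_pmf.expectation M (\<lambda>\<omega>. exp (s * Y \<omega>)) \<le>
      measure_pmf.expectation M (\<lambda>\<omega>. exp (h * x) * exp ((s - h) * Y \<omega>) +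
        exp (- h * y) * exp ((s + h) * Y \<omega>) + exp (s * y) * indicator {\<omega>. x \<le> Y \<omega>} \<omega>)"
  proof (intro integral_mono)
    fix \<omega>
    consider "Y \<omega> < x" | "y < Y \<omega>" | "x \<le> Y \<omega>" "Y \<omega> \<le> y" by linarith
    then show "exp (s * Y \<omega>) \<le> exp (h * x) * exp ((s - h) * Y \<omega>) +
        exp (- h * y) * exp ((s + h) * Y \<omega>) + exp (s * y) * indicator {\<omega>. x \<le> Y \<omega>} \<omega>"
    proof cases
      case 1
      have "s * Y \<omega> \<le> h * x + (s - h) * Y \<omega>"
        using mult_left_mono[of "Y \<omega>" x h] 1 assms by (simp add: algebra_simps)
      then have "exp (s * Y \<omega>) \<le> exp (h * x) * exp ((s - h) * Y \<omega>)"
        by (simp flip: exp_add)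
      then show ?thesis by (simp add: add_increasing2)
    next
      case 2
      have "s * Y \<omega> \<le> - h * y + (s + h) * Y \<omega>"
        using mult_left_mono[of y "Y \<omega>" h] 2 assms by (simp add: algebra_simps)
      then have "exp (s * Y \<omega>) \<le> exp (- h * y) * exp ((s + h) * Y \<omega>)"
        by (simp flip: exp_add)
      then show ?thesis by (simp add: add_increasing add_increasing2)
    next
      case 3
      then have "exp (s * Y \<omega>) \<le> exp (s * y)"
        using assms by (simp add: mult_left_mono)
      then show ?thesis using 3 by (simp add: add_increasing)
    qed
  qed (use int ind in \<open>auto intro!: integrable_add\<close>)
  also have "\<dots> = exp (h * x) * measure_pmf.expectation M (\<lambda>\<omega>. exp ((s - h) * Y \<omega>)) +
      exp (- h * y) * measure_pmf.expectation M (\<lambda>\<omega>. exp ((s + h) * Y \<omega>)) +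
      exp (s * y) * measure_pmf.prob M {\<omega>. x \<le> Y \<omega>}"
    using int ind by simp
  finally show ?thesis .
qed

lemma prob_le_exp_mgf:
  fixes M :: "'a pmf" and Y :: "'a \<Rightarrow> real"
  assumes int: "integrable (measure_pmf M) (\<lambda>\<omega>. exp (s * Y \<omega>))" and "0 \<le> s"
  shows "measure_pmf.prob M {\<omega>. x \<le> Y \<omega>} \<le>
      exp (- s * x) * measure_pmf.expectation M (\<lambda>\<omega>. exp (s * Y \<omega>))"
proof -
  have "measure_pmf.prob M {\<omega>. x \<le> Y \<omega>} = measure_pmf.expectation M (indicator {\<omega>. x \<le> Y \<omega>})"
    by simp
  also have "\<dots> \<le> measure_pmf.expectation M (\<lambda>\<omega>. exp (- s * x) * exp (s * Y \<omega>))"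
  proof (intro integral_mono)
    show "indicator {\<omega>. x \<le> Y \<omega>} \<omega> \<le> exp (- s * x) * exp (s * Y \<omega>)" for \<omega>
      using mult_left_mono[of x "Y \<omega>" s] assms(2) by (auto simp: indicator_def simp flip: exp_add)
  qed (use int in \<open>auto simp: measure_pmf.emeasure_eq_measure\<close>)
  finally show ?thesis by simp
qed

lemma mgf_pos:
  fixes M :: "'a pmf" and f :: "'a \<Rightarrow> real"
  assumes int: "integrable (measure_pmf M) (\<lambda>\<omega>. exp (f \<omega>))"
  shows "0 < measure_pmf.expectation M (\<lambda>\<omega>. exp (f \<omega>))"
proof -
  have "measure_pmf.expectation M (\<lambda>\<omega>. exp (f \<omega>)) \<noteq> 0"
    using integral_nonneg_eq_0_iff_AE[OF int] set_pmf_not_empty[of M]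
    by (auto simp: AE_measure_pmf_iff)
  moreover have "0 \<le> measure_pmf.expectation M (\<lambda>\<omega>. exp (f \<omega>))"
    by simp
  ultimately show ?thesis by linarith
qed

text \<open>
  The hypothesis says that at speed \<open>r\<close> the variables \<open>Y m\<close> look like centred Gaussian variables of
  variance \<open>c / r m\<close>.
\<close>

context
  fixes p :: "nat \<Rightarrow> 'a pmf" and Y :: "nat \<Rightarrow> 'a \<Rightarrow> real" and r :: "nat \<Rightarrow> real" and c \<delta> :: real
  assumes int: "\<And>m t. integrable (measure_pmf (p m)) (\<lambda>\<omega>. exp (t * Y m \<omega>))"
    and speed: "filterlim r at_top sequentially"
    and c: "0 < c" and \<delta>: "0 \<le> \<delta>"
    and cgf: "\<And>t. (\<lambda>m. ln (measure_pmf.expectation (p m) (\<lambda>\<omega>. exp (t * r m * Y m \<omega>))) / r m)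
      \<longlonglongrightarrow> c * t\<^sup>2 / 2"
begin

text \<open>
  The window reaches from \<open>\<delta>\<close> to \<open>\<delta> + 2 * \<eta>\<close>, and the tilt is the one that moves the mean to its
  midpoint. Then both Chernoff bounds gain the same exponent \<open>\<kappa>\<close>.
\<close>

lemma quadratic_cgf_lower_bound:
  assumes \<eta>: "0 < \<eta>"
  shows "\<forall>\<^sub>F m in sequentially. 0 < measure_pmf.prob (p m) {\<omega>. \<delta> \<le> Y m \<omega>} \<and>
    - (\<delta> + 2 * \<eta>)\<^sup>2 / (2 * c) \<le> ln (measure_pmf.prob (p m) {\<omega>. \<delta> \<le> Y m \<omega>}) / r m"
proof -
  define G where "G t m = measure_pmf.expectation (p m) (\<lambda>\<omega>. exp (t * r m * Y m \<omega>))" for t m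
  define L where "L t m = ln (G t m) / r m" for t m
  have G: "G t m = exp (r m * L t m)" if "0 < r m" for t m
    using that mgf_pos[OF int[of m "t * r m"]] by (simp add: L_def G_def)
  have L: "L t \<longlonglongrightarrow> c * t\<^sup>2 / 2" for t
    using cgf unfolding L_def G_def .
  \<comment> \<open>\<open>t\<close> has mean \<open>c * t = \<delta> + \<eta>\<close>; \<open>h\<close> is the optimal additional tilt for deviations by \<open>\<eta>\<close> from
    this mean, and \<open>\<kappa>\<close> is their rate.\<close>
  define t h \<kappa> where "t = (\<delta> + \<eta>) / c" and "h = \<eta> / c" and "\<kappa> = \<eta>\<^sup>2 / (2 * c)"
  have pos: "0 \<le> t" "0 \<le> h" "0 < \<kappa>"
    using c \<delta> \<eta> by (auto simp: t_def h_def \<kappa>_def)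
  have left: "h * \<delta> + c * (t - h)\<^sup>2 / 2 = c * t\<^sup>2 / 2 - \<kappa>"
    and right: "- h * (\<delta> + 2 * \<eta>) + c * (t + h)\<^sup>2 / 2 = c * t\<^sup>2 / 2 - \<kappa>"
    and rate: "- t * (\<delta> + 2 * \<eta>) + c * t\<^sup>2 / 2 - \<kappa> = - (\<delta> + 2 * \<eta>)\<^sup>2 / (2 * c)"
    using c by (simp_all add: t_def h_def \<kappa>_def field_simps power2_eq_square)
  \<comment> \<open>Approximating \<open>L\<close> within \<open>\<kappa> / 4\<close> at \<open>t\<close> and \<open>t \<plusminus> h\<close> leaves a gain of \<open>\<kappa> / 2\<close>, enough for each of
    the two Chernoff terms to be at most a quarter of the whole.\<close>
  have "\<forall>\<^sub>F m in sequentially. ln 4 * 2 / \<kappa> \<le> r m" "\<forall>\<^sub>F m in sequentially. 0 < r m"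
    using speed unfolding filterlim_at_top_dense
    by (blast intro: eventually_mono less_imp_le)+
  moreover have "\<forall>\<^sub>F m in sequentially. c * t\<^sup>2 / 2 - \<kappa> / 4 < L t m"
    "\<forall>\<^sub>F m in sequentially. L (t - h) m < c * (t - h)\<^sup>2 / 2 + \<kappa> / 4"
    "\<forall>\<^sub>F m in sequentially. L (t + h) m < c * (t + h)\<^sup>2 / 2 + \<kappa> / 4"
    using pos by (intro order_tendstoD[OF L]; simp)+
  ultimately show ?thesis
  proof eventually_elim
    case (elim m)
    let ?P = "measure_pmf.prob (p m) {\<omega>. \<delta> \<le> Y m \<omega>}"
    have large: "ln 4 \<le> r m * (\<kappa> / 2)"
      using elim(1) pos by (simp add: field_simps)
    have quarter: "exp (r m * E) \<le> G t m / 4" if "E \<le> L t m - \<kappa> / 2" for E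
    proof -
      have "r m * E \<le> r m * L t m - ln 4"
        using mult_left_mono[OF that, of "r m"] large elim(2) by (simp add: algebra_simps)
      then have "exp (r m * E) \<le> exp (r m * L t m - ln 4)" by simp
      then show ?thesis using G[OF elim(2)] by (simp add: exp_diff)
    qed
    have "exp (h * r m * \<delta>) * G (t - h) m = exp (r m * (h * \<delta> + L (t - h) m))"
      by (simp add: G[OF elim(2)] algebra_simps flip: exp_add)
    also have "\<dots> \<le> G t m / 4"
      using elim left by (intro quarter) linarith
    finally have A: "exp (h * r m * \<delta>) * G (t - h) m \<le> G t m / 4" .
    have "exp (- (h * r m) * (\<delta> + 2 * \<eta>)) * G (t + h) m
        = exp (r m * (- h * (\<delta> + 2 * \<eta>) + L (t + h) m))"
      by (simp add: G[OF elim(2)] algebra_simps flip: exp_add)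
    also have "\<dots> \<le> G t m / 4"
      using elim right by (intro quarter) linarith
    finally have B: "exp (- (h * r m) * (\<delta> + 2 * \<eta>)) * G (t + h) m \<le> G t m / 4" .
    have "G t m \<le> exp (h * r m * \<delta>) * G (t - h) m
        + exp (- (h * r m) * (\<delta> + 2 * \<eta>)) * G (t + h) m + exp (t * r m * (\<delta> + 2 * \<eta>)) * ?P"
      using mgf_le_shifted_mgfs_plus_tail[OF int[of m], of "t * r m" "h * r m" \<delta> "\<delta> + 2 * \<eta>"]
        pos elim(2) by (simp add: G_def algebra_simps)
    then have "G t m / 2 \<le> exp (t * r m * (\<delta> + 2 * \<eta>)) * ?P"
      using A B by linarith
    then have "G t m / 2 / exp (t * r m * (\<delta> + 2 * \<eta>)) \<le> ?P"
      by (subst pos_divide_le_eq) (simp_all add: mult.commute)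
    moreover have "r m * (- t * (\<delta> + 2 * \<eta>) + L t m) - ln 2
        = r m * L t m - ln 2 - t * r m * (\<delta> + 2 * \<eta>)"
      by (simp add: algebra_simps)
    then have "exp (r m * (- t * (\<delta> + 2 * \<eta>) + L t m) - ln 2)
        = G t m / 2 / exp (t * r m * (\<delta> + 2 * \<eta>))"
      by (simp add: G[OF elim(2)] exp_diff)
    ultimately have P: "exp (r m * (- t * (\<delta> + 2 * \<eta>) + L t m) - ln 2) \<le> ?P" by simp
    then have P_pos: "0 < ?P" using exp_gt_zero less_le_trans by blast
    have "r m * (- (\<delta> + 2 * \<eta>)\<^sup>2 / (2 * c)) \<le> r m * (- t * (\<delta> + 2 * \<eta>) + L t m - \<kappa> / 2)"
      using elim(2,3) pos rate by (intro mult_left_mono) linarith+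
    also have "\<dots> \<le> r m * (- t * (\<delta> + 2 * \<eta>) + L t m) - ln 2"
    proof -
      have "ln 2 \<le> ln (4::real)" by simp
      then have "ln 2 \<le> r m * (\<kappa> / 2)" using large by linarith
      then show ?thesis by (simp add: algebra_simps)
    qed
    also have "\<dots> \<le> ln ?P" using P P_pos by (simp add: ln_ge_iff)
    finally show ?case using P_pos elim(2) by (simp add: field_simps)
  qed
qed

text \<open>
  The upper bound is Chernoff's with the optimal tilt \<open>\<delta> / c\<close>; the lower bound is the previous one for
  \<open>\<eta>\<close> tending to zero.
\<close>

lemma quadratic_cgf_large_deviations:
  "(\<lambda>m. ln (measure_pmf.prob (p m) {\<omega>. \<delta> \<le> Y m \<omega>}) / r m) \<longlonglongrightarrow> - \<delta>\<^sup>2 / (2 * c)"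
proof (rule order_tendstoI)
  fix b assume "b < - \<delta>\<^sup>2 / (2 * c)"
  moreover have "((\<lambda>\<eta>. - (\<delta> + 2 * \<eta>)\<^sup>2 / (2 * c)) \<longlongrightarrow> - (\<delta> + 2 * 0)\<^sup>2 / (2 * c)) (at_right 0)"
    using c by (intro tendsto_intros) auto
  ultimately have "\<forall>\<^sub>F \<eta> in at_right 0. b < - (\<delta> + 2 * \<eta>)\<^sup>2 / (2 * c) \<and> 0 < \<eta>"
    by (intro eventually_conj eventually_at_right_less order_tendstoD(1)) auto
  then obtain \<eta> where \<eta>: "b < - (\<delta> + 2 * \<eta>)\<^sup>2 / (2 * c)" "0 < \<eta>"
    using eventually_happens[of _ "at_right (0::real)"] trivial_limit_at_right_real by blast
  show "\<forall>\<^sub>F m in sequentially. b < ln (measure_pmf.prob (p m) {\<omega>. \<delta> \<le> Y m \<omega>}) / r m"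
    using quadratic_cgf_lower_bound[OF \<eta>(2)] by eventually_elim (use \<eta>(1) in linarith)
next
  fix b assume b: "- \<delta>\<^sup>2 / (2 * c) < b"
  define t where "t = \<delta> / c"
  define L where "L m = ln (measure_pmf.expectation (p m) (\<lambda>\<omega>. exp (t * r m * Y m \<omega>))) / r m" for m
  have "(\<lambda>m. - t * \<delta> + L m) \<longlonglongrightarrow> - t * \<delta> + c * t\<^sup>2 / 2"
    unfolding L_def by (intro tendsto_add tendsto_const cgf)
  also have "- t * \<delta> + c * t\<^sup>2 / 2 = - \<delta>\<^sup>2 / (2 * c)"
    using c by (simp add: t_def field_simps power2_eq_square)
  finally have "\<forall>\<^sub>F m in sequentially. - t * \<delta> + L m < b"
    using b by (rule order_tendstoD)
  moreover have "\<forall>\<^sub>F m in sequentially. 0 < r m"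
    using speed by (auto simp: filterlim_at_top_dense)
  ultimately show "\<forall>\<^sub>F m in sequentially. ln (measure_pmf.prob (p m) {\<omega>. \<delta> \<le> Y m \<omega>}) / r m < b"
    using quadratic_cgf_lower_bound[OF zero_less_one]
  proof eventually_elim
    case (elim m)
    let ?P = "measure_pmf.prob (p m) {\<omega>. \<delta> \<le> Y m \<omega>}"
    let ?G = "measure_pmf.expectation (p m) (\<lambda>\<omega>. exp (t * r m * Y m \<omega>))"
    have G: "0 < ?G" by (rule mgf_pos[OF int])
    have "?P \<le> exp (- (t * r m) * \<delta>) * ?G"
      using elim c \<delta> by (intro prob_le_exp_mgf int) (simp add: t_def)
    then have "ln ?P \<le> ln (exp (- (t * r m) * \<delta>) * ?G)"
      using elim G by (subst ln_le_cancel_iff) auto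
    also have "\<dots> = r m * (- t * \<delta> + L m)"
      using G elim by (simp add: ln_mult L_def algebra_simps)
    finally have "ln ?P / r m \<le> - t * \<delta> + L m"
      using elim by (simp add: field_simps)
    then show ?case using elim by linarith
  qed
qed

end

section \<open>Moderate deviations of the drift\<close>

lemma sum_squared_differences:
  fixes x :: real
  shows "(\<Sum>h = 1..n. (x - real h)\<^sup>2)
    = real n * x\<^sup>2 - real n * (real n + 1) * x + real n * (real n + 1) * (2 * real n + 1) / 6"
  by (induction n) (auto simp: field_simps power2_eq_square)

text \<open>
  Second-order Taylor expansion: a centred address has mean \<open>0\<close> and variance \<open>(m\<^sup>2 - 1) / 12\<close>. The
  constant \<open>1\<close> in front of the cubic error absorbs \<open>exp 1 / 6\<close>.
\<close>

lemma mgf_uniform_taylor: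
  fixes \<theta> :: real
  assumes m: "0 < m" and small: "\<bar>\<theta>\<bar> * real m \<le> 1"
  shows "\<bar>measure_pmf.expectation (pmf_of_set {1..m}) (\<lambda>h. exp (\<theta> * ((real m + 1) / 2 - real h)))
      - 1 - \<theta>\<^sup>2 * ((real m)\<^sup>2 - 1) / 24\<bar> \<le> (\<bar>\<theta>\<bar> * real m) ^ 3"
proof -
  define v where "v h = (real m + 1) / 2 - real h" for h
  have rem: "\<bar>exp (\<theta> * v h) - 1 - \<theta> * v h - \<theta>\<^sup>2 * (v h)\<^sup>2 / 2\<bar> \<le> (\<bar>\<theta>\<bar> * real m) ^ 3"
    if "h \<in> {1..m}" for h
  proof -
    have "\<bar>v h\<bar> \<le> real m" using that by (auto simp: v_def abs_le_iff field_simps)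
    then have x: "\<bar>\<theta> * v h\<bar> \<le> \<bar>\<theta>\<bar> * real m" by (simp add: abs_mult mult_left_mono)
    obtain t where t: "\<bar>t\<bar> \<le> \<bar>\<theta> * v h\<bar>"
      "exp (\<theta> * v h) = (\<Sum>k<3. (\<theta> * v h) ^ k / fact k) + exp t / fact 3 * (\<theta> * v h) ^ 3"
      using Maclaurin_exp_le[of "\<theta> * v h" 3] by blast
    have "exp t \<le> exp 1" using t(1) x small by simp
    also have "\<dots> \<le> 6" using exp_le by simp
    finally have "exp t / 6 * \<bar>\<theta> * v h\<bar> ^ 3 \<le> 1 * (\<bar>\<theta>\<bar> * real m) ^ 3"
      using x by (intro mult_mono power_mono) auto
    moreover have "exp (\<theta> * v h) - 1 - \<theta> * v h - \<theta>\<^sup>2 * (v h)\<^sup>2 / 2 = exp t / 6 * (\<theta> * v h) ^ 3"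
      unfolding t(2) by (simp add: eval_nat_numeral field_simps)
    moreover have "\<bar>exp t / 6 * (\<theta> * v h) ^ 3\<bar> = exp t / 6 * \<bar>\<theta> * v h\<bar> ^ 3"
      by (simp only: abs_mult[of "exp t / 6"] power_abs) simp
    ultimately show ?thesis by simp
  qed
  have mean: "(\<Sum>h = 1..m. v h) = 0"
  proof -
    have "(\<Sum>h = 1..m. real h) = real m * ((real m + 1) / 2)"
      using double_gauss_sum_from_Suc_0[of m, where 'a = real] by (simp add: field_simps)
    then show ?thesis by (simp add: v_def sum_subtractf del: One_nat_def)
  qed
  have var: "(\<Sum>h = 1..m. (v h)\<^sup>2) = real m * ((real m)\<^sup>2 - 1) / 12"
    unfolding v_def sum_squared_differences by (simp add: field_simps power2_eq_square)
  have "(\<Sum>h = 1..m. exp (\<theta> * v h) - 1 - \<theta> * v h - \<theta>\<^sup>2 * (v h)\<^sup>2 / 2)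
      = (\<Sum>h = 1..m. exp (\<theta> * v h)) - real m - \<theta> * (\<Sum>h = 1..m. v h)
        - \<theta>\<^sup>2 / 2 * (\<Sum>h = 1..m. (v h)\<^sup>2)"
    by (simp add: sum_subtractf sum_distrib_left)
  then have "\<bar>(\<Sum>h = 1..m. exp (\<theta> * v h)) - real m - \<theta>\<^sup>2 * (real m * ((real m)\<^sup>2 - 1)) / 24\<bar>
      = \<bar>\<Sum>h = 1..m. exp (\<theta> * v h) - 1 - \<theta> * v h - \<theta>\<^sup>2 * (v h)\<^sup>2 / 2\<bar>"
    unfolding mean var by simp
  also have "\<dots> \<le> (\<Sum>h = 1..m. (\<bar>\<theta>\<bar> * real m) ^ 3)"
    using rem by (intro sum_abs[THEN order_trans] sum_mono)
  finally have "\<bar>(\<Sum>h = 1..m. exp (\<theta> * v h)) - real m - \<theta>\<^sup>2 * (real m * ((real m)\<^sup>2 - 1)) / 24\<bar> / real m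
      \<le> (\<bar>\<theta>\<bar> * real m) ^ 3"
    using m by (simp add: field_simps)
  moreover have "measure_pmf.expectation (pmf_of_set {1..m}) (\<lambda>h. exp (\<theta> * v h))
      - 1 - \<theta>\<^sup>2 * ((real m)\<^sup>2 - 1) / 24
      = ((\<Sum>h = 1..m. exp (\<theta> * v h)) - real m - \<theta>\<^sup>2 * (real m * ((real m)\<^sup>2 - 1)) / 24) / real m"
    using m by (simp add: integral_pmf_of_set field_simps)
  ultimately show ?thesis
    unfolding v_def[symmetric] by (simp only: abs_divide abs_of_nat)
qed

lemma mgf_drift:
  "measure_pmf.expectation (addresses m m) (\<lambda>a. exp (\<theta> * drift m a)) =
    measure_pmf.expectation (pmf_of_set {1..m}) (\<lambda>h. exp (\<theta> * ((real m + 1) / 2 - real h))) ^ m"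
proof (cases "m = 0")
  case False
  have "measure_pmf.expectation (addresses m m) (\<lambda>a. exp (\<theta> * drift m a)) =
      measure_pmf.expectation (addresses m m)
        (\<lambda>a. \<Prod>i = 1..m. exp (\<theta> * ((real m + 1) / 2 - real (a i))))"
    by (simp add: drift_def sum_distrib_left exp_sum)
  also have "\<dots> = (\<Prod>i = 1..m. measure_pmf.expectation (pmf_of_set {1..m})
      (\<lambda>h. exp (\<theta> * ((real m + 1) / 2 - real h))))"
    unfolding addresses_def using False
    by (intro expectation_prod_Pi_pmf integrable_measure_pmf_finite) auto
  finally show ?thesis by simp
qed (simp add: drift_def)

text \<open>
  The logarithm is \<open>m * ln (1 + u)\<close>, where \<open>u\<close> is the excess over \<open>1\<close> of the moment generating
  function of one centred address at \<open>\<theta> = t * m powr (\<alpha> - 3)\<close>. The quadratic term of \<open>u\<close> gives the limit.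
  The cubic term, relative to it, is of order \<open>\<theta> * m\<close>, which vanishes because \<open>\<alpha> < 2\<close>; so \<open>u\<close> tends to \<open>0\<close>
  and \<open>ln (1 + u)\<close> may be replaced by \<open>u\<close>.
\<close>

lemma drift_cgf_limit:
  fixes \<alpha> t :: real
  assumes \<alpha>: "3 / 2 < \<alpha>" "\<alpha> < 2"
  shows "(\<lambda>m. ln (measure_pmf.expectation (addresses m m)
      (\<lambda>a. exp (t * real m powr (2 * \<alpha> - 3) * (drift m a / real m powr \<alpha>)))) / real m powr (2 * \<alpha> - 3))
    \<longlonglongrightarrow> t\<^sup>2 / 24"
proof -
  define \<theta> where "\<theta> m = t * real m powr (\<alpha> - 3)" for m
  define u where "u m = measure_pmf.expectation (pmf_of_set {1..m})
      (\<lambda>h. exp (\<theta> m * ((real m + 1) / 2 - real h))) - 1" for m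
  have "(\<lambda>m. \<bar>t\<bar> * real m powr (\<alpha> - 3) * real m) \<longlonglongrightarrow> 0"
    using \<alpha> by real_asymp
  from order_tendstoD(2)[OF this zero_less_one]
  have "\<forall>\<^sub>F m in sequentially. \<bar>\<theta> m\<bar> * real m < 1"
    by (simp add: \<theta>_def abs_mult)
  then have small: "\<forall>\<^sub>F m in sequentially. 0 < m \<and> \<bar>\<theta> m\<bar> * real m \<le> 1"
    using eventually_gt_at_top[of 0] by eventually_elim auto
  have main: "(\<lambda>m. real m powr (4 - 2 * \<alpha>) * ((\<theta> m)\<^sup>2 * ((real m)\<^sup>2 - 1) / 24)) \<longlonglongrightarrow> t\<^sup>2 / 24"
    unfolding \<theta>_def power_mult_distrib by real_asymp
  have "(\<lambda>m. real m powr (4 - 2 * \<alpha>) * (u m - (\<theta> m)\<^sup>2 * ((real m)\<^sup>2 - 1) / 24)) \<longlonglongrightarrow> 0"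
  proof (rule Lim_null_comparison)
    show "(\<lambda>m. real m powr (4 - 2 * \<alpha>) * (\<bar>t\<bar> * real m powr (\<alpha> - 3) * real m) ^ 3) \<longlonglongrightarrow> 0"
      unfolding power_mult_distrib using \<alpha> by real_asymp
    show "\<forall>\<^sub>F m in sequentially. norm (real m powr (4 - 2 * \<alpha>) * (u m - (\<theta> m)\<^sup>2 * ((real m)\<^sup>2 - 1) / 24))
        \<le> real m powr (4 - 2 * \<alpha>) * (\<bar>t\<bar> * real m powr (\<alpha> - 3) * real m) ^ 3"
      using small
    proof eventually_elim
      case (elim m)
      have "\<bar>u m - (\<theta> m)\<^sup>2 * ((real m)\<^sup>2 - 1) / 24\<bar> \<le> (\<bar>\<theta> m\<bar> * real m) ^ 3"
        using mgf_uniform_taylor[of m "\<theta> m"] elim by (simp add: u_def)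
      also have "\<bar>\<theta> m\<bar> = \<bar>t\<bar> * real m powr (\<alpha> - 3)" by (simp add: \<theta>_def abs_mult)
      finally show ?case by (simp add: abs_mult mult_left_mono)
    qed
  qed
  from tendsto_add[OF main this]
  have scaled: "(\<lambda>m. real m powr (4 - 2 * \<alpha>) * u m) \<longlonglongrightarrow> t\<^sup>2 / 24"
    by (simp add: algebra_simps)
  have "(\<lambda>m. real m powr (2 * \<alpha> - 4)) \<longlonglongrightarrow> 0" using \<alpha> by real_asymp
  from tendsto_mult[OF this scaled]
  have "(\<lambda>m. real m powr (2 * \<alpha> - 4) * (real m powr (4 - 2 * \<alpha>) * u m)) \<longlonglongrightarrow> 0"
    by simp
  then have u0: "u \<longlonglongrightarrow> 0"
  proof (rule Lim_transform_eventually)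
    show "\<forall>\<^sub>F m in sequentially. real m powr (2 * \<alpha> - 4) * (real m powr (4 - 2 * \<alpha>) * u m) = u m"
      using eventually_gt_at_top[of 0]
      by eventually_elim (simp add: mult.assoc[symmetric] flip: powr_add)
  qed
  have lower: "(\<lambda>m. real m powr (4 - 2 * \<alpha>) * u m / (1 + u m)) \<longlonglongrightarrow> t\<^sup>2 / 24"
    using tendsto_divide[OF scaled tendsto_add[OF tendsto_const[of 1] u0]] by simp
  have u_pos: "\<forall>\<^sub>F m in sequentially. - 1 / 2 < u m"
    using u0 by (rule order_tendstoD) simp
  have eq: "\<forall>\<^sub>F m in sequentially. real m powr (4 - 2 * \<alpha>) * ln (1 + u m) =
      ln (measure_pmf.expectation (addresses m m)
        (\<lambda>a. exp (t * real m powr (2 * \<alpha> - 3) * (drift m a / real m powr \<alpha>)))) / real m powr (2 * \<alpha> - 3)"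
    using eventually_gt_at_top[of 0] u_pos
  proof eventually_elim
    case (elim m)
    have speed: "real m powr (2 * \<alpha> - 3) / real m powr \<alpha> = real m powr (\<alpha> - 3)"
      by (simp flip: powr_diff)
    have "t * real m powr (2 * \<alpha> - 3) * (drift m a / real m powr \<alpha>) = \<theta> m * drift m a" for a
      unfolding \<theta>_def speed[symmetric] by simp
    then have "measure_pmf.expectation (addresses m m)
        (\<lambda>a. exp (t * real m powr (2 * \<alpha> - 3) * (drift m a / real m powr \<alpha>))) = (1 + u m) ^ m"
      by (simp add: mgf_drift u_def)
    moreover have "real m / real m powr (2 * \<alpha> - 3) = real m powr (4 - 2 * \<alpha>)"
      using elim(1) powr_diff[of "real m" 1 "2 * \<alpha> - 3"] by simp
    ultimately show ?case
      using elim by (simp add: ln_realpow field_simps)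
  qed
  have "(\<lambda>m. real m powr (4 - 2 * \<alpha>) * ln (1 + u m)) \<longlonglongrightarrow> t\<^sup>2 / 24"
  proof (rule tendsto_sandwich[OF _ _ lower scaled])
    show "\<forall>\<^sub>F m in sequentially. real m powr (4 - 2 * \<alpha>) * u m / (1 + u m)
        \<le> real m powr (4 - 2 * \<alpha>) * ln (1 + u m)"
      using u_pos
    proof eventually_elim
      case (elim m)
      have "u m / (1 + u m) = 1 - inverse (1 + u m)" using elim by (simp add: field_simps)
      also have "\<dots> \<le> ln (1 + u m)"
        using ln_le_minus_one[of "inverse (1 + u m)"] elim by (simp add: ln_inverse)
      finally have "real m powr (4 - 2 * \<alpha>) * (u m / (1 + u m)) \<le> real m powr (4 - 2 * \<alpha>) * ln (1 + u m)"
        by (rule mult_left_mono) simp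
      then show ?case by simp
    qed
    show "\<forall>\<^sub>F m in sequentially. real m powr (4 - 2 * \<alpha>) * ln (1 + u m) \<le> real m powr (4 - 2 * \<alpha>) * u m"
      using u_pos by eventually_elim (intro mult_left_mono, use ln_add_one_self_le_self2 in auto)
  qed
  then show ?thesis using eq by (rule Lim_transform_eventually)
qed

lemma drift_moderate_deviations:
  fixes \<alpha> \<delta> :: real
  assumes \<alpha>: "3 / 2 < \<alpha>" "\<alpha> < 2" and \<delta>: "0 \<le> \<delta>"
  defines "P m \<equiv> measure_pmf.prob (addresses m m) {a. real m powr \<alpha> * \<delta> \<le> drift m a}"
  shows "(\<lambda>m. ln (P m) / real m powr (2 * \<alpha> - 3)) \<longlonglongrightarrow> - 6 * \<delta>\<^sup>2"
    and "\<forall>\<^sub>F m in sequentially. 0 < P m"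
proof -
  let ?Y = "\<lambda>m a. drift m a / real m powr \<alpha>"
  let ?r = "\<lambda>m::nat. real m powr (2 * \<alpha> - 3)"
  have fin: "finite (set_pmf (addresses m m))" for m
    using finite_set_pmf_addresses[of m m] by (cases "m = 0") (auto simp: addresses_def)
  have int: "integrable (measure_pmf (addresses m m)) (\<lambda>a. exp (t * ?Y m a))" for m t
    using fin by (rule integrable_measure_pmf_finite)
  have speed: "filterlim ?r at_top sequentially" using \<alpha> by real_asymp
  have cgf: "(\<lambda>m. ln (measure_pmf.expectation (addresses m m) (\<lambda>a. exp (t * ?r m * ?Y m a))) / ?r m)
      \<longlonglongrightarrow> 1 / 12 * t\<^sup>2 / 2" for t
    using drift_cgf_limit[OF \<alpha>, of t] by simp
  have P: "\<forall>\<^sub>F m in sequentially. measure_pmf.prob (addresses m m) {a. \<delta> \<le> ?Y m a} = P m"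
    using eventually_gt_at_top[of 0] by eventually_elim (simp add: P_def field_simps)
  have c: "(0::real) < 1 / 12" by simp
  have "(\<lambda>m. ln (measure_pmf.prob (addresses m m) {a. \<delta> \<le> ?Y m a}) / ?r m) \<longlonglongrightarrow> - 6 * \<delta>\<^sup>2"
    using quadratic_cgf_large_deviations[OF int speed c \<delta> cgf] by (simp add: mult.commute)
  then show "(\<lambda>m. ln (P m) / ?r m) \<longlonglongrightarrow> - 6 * \<delta>\<^sup>2"
    by (rule Lim_transform_eventually) (use P in \<open>eventually_elim, simp\<close>)
  show "\<forall>\<^sub>F m in sequentially. 0 < P m"
    using quadratic_cgf_lower_bound[OF int speed c \<delta> cgf zero_less_one] P
    by eventually_elim simp
qed

section \<open>Moderate deviations of the total displacement\<close>

theorem theorem2: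
  fixes \<alpha> \<delta> :: real
  assumes "3 / 2 < \<alpha>" and "\<alpha> < 2" and "0 \<le> \<delta>"
  shows "(\<lambda>m::nat. 1 / real m powr (2 * \<alpha> - 3) *
           ln (measure_pmf.prob (addresses m m)
                 {a. real (total_displacement m m a) \<ge> real m powr \<alpha> * \<delta>}))
         \<longlonglongrightarrow> - 6 * \<delta>\<^sup>2"
proof -
  define P where "P m = measure_pmf.prob (addresses m m) {a. real m powr \<alpha> * \<delta> \<le> drift m a}" for m
  define D where "D m = measure_pmf.prob (addresses m m)
      {a. real (total_displacement m m a) \<ge> real m powr \<alpha> * \<delta>}" for m
  note P = drift_moderate_deviations[OF assms, folded P_def]
  have "(\<lambda>m::nat. ln (real m) / real m powr (2 * \<alpha> - 3)) \<longlonglongrightarrow> 0"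
    using assms by real_asymp
  from tendsto_add[OF this P(1)]
  have upper: "(\<lambda>m. ln (real m) / real m powr (2 * \<alpha> - 3) + ln (P m) / real m powr (2 * \<alpha> - 3))
      \<longlonglongrightarrow> - 6 * \<delta>\<^sup>2" by simp
  have bounds: "\<forall>\<^sub>F m in sequentially. 0 < m \<and> 0 < P m \<and> P m \<le> D m \<and> D m \<le> real m * P m"
    using P(2) eventually_gt_at_top[of 0]
    by eventually_elim (simp add: P_def D_def prob_total_displacement_bounds)
  have "(\<lambda>m. ln (D m) / real m powr (2 * \<alpha> - 3)) \<longlonglongrightarrow> - 6 * \<delta>\<^sup>2"
  proof (rule tendsto_sandwich[OF _ _ P(1) upper])
    show "\<forall>\<^sub>F m in sequentially. ln (P m) / real m powr (2 * \<alpha> - 3) \<le> ln (D m) / real m powr (2 * \<alpha> - 3)"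
      using bounds by eventually_elim (auto intro!: divide_right_mono)
    show "\<forall>\<^sub>F m in sequentially. ln (D m) / real m powr (2 * \<alpha> - 3)
        \<le> ln (real m) / real m powr (2 * \<alpha> - 3) + ln (P m) / real m powr (2 * \<alpha> - 3)"
      using bounds
    proof eventually_elim
      case (elim m)
      then have "ln (D m) \<le> ln (real m * P m)" by (subst ln_le_cancel_iff) auto
      also have "\<dots> = ln (real m) + ln (P m)" using elim by (simp add: ln_mult)
      finally show ?case by (simp add: divide_right_mono flip: add_divide_distrib)
    qed
  qed
  then show ?thesis by (simp add: D_def)
qed

end
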